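(* Let $\mathcal{G}_1=\{g_i: i\in\mathcal{I}\}$ and $\mathcal{G}_2=\{h_j: j\in\mathcal{J}\}$ be two frames for $\mathbf{L}^2(\mathbb{R}^d)$, let $A_1$ be the lower frame bound of $\mathcal{G}_1$, and let $\mathcal{F}_1\subset\mathcal{I}$ and $\mathcal{F}_2\subset\mathcal{J}$ be finite. If there is a bounded linear mapping $L:\ell^2(\mathcal{F}_1)\to\ell^2(\mathcal{F}_2)$ such that $$\|T^*_{g,\mathcal{F}_1}-T^*_{h,\mathcal{F}_2}L\|^2=C<\frac{A_1}{2},$$ where the norm is the operator norm from $\ell^2(\mathcal{F}_1)$ to $\mathbf{L}^2(\mathbb{R}^d)$, then the set $$\{g_i: i\in\mathcal{I}\setminus\mathcal{F}_1\}\cup\{h_j: j\in\mathcal{F}_2\}$$ is a frame for $\mathbf{L}^2(\mathbb{R}^d)$ with a lower frame bound given by $(A_1-2C)/\max(1,2\|L^*\|^2)$, where $\|L^*\|$ is the operator norm of the adjoint $L^*:\ell^2(\mathcal{F}_2)\to\ell^2(\mathcal{F}_1)$.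
   Context: A family $(f_k)_{k\in K}$ in $\mathbf{L}^2(\mathbb{R}^d)$ is a frame with lower and upper frame bounds $A,B>0$ if $A\|f\|_2^2\le\sum_{k\in K}|\langle f,f_k\rangle|^2\le B\|f\|_2^2$ for all $f\in\mathbf{L}^2(\mathbb{R}^d)$. The synthesis operators are $T^*_{g,\mathcal{F}_1}:\ell^2(\mathcal{F}_1)\to\mathbf{L}^2(\mathbb{R}^d)$, $(c_i)_{i\in\mathcal{F}_1}\mapsto\sum_{i\in\mathcal{F}_1}c_ig_i$, and $T^*_{h,\mathcal{F}_2}:\ell^2(\mathcal{F}_2)\to\mathbf{L}^2(\mathbb{R}^d)$, $(c_j)_{j\in\mathcal{F}_2}\mapsto\sum_{j\in\mathcal{F}_2}c_jh_j$. The union in the conclusion is understood as a family indexed by $(\mathcal{I}\setminus\mathcal{F}_1)\sqcup\mathcal{F}_2$. *)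

theory Defs
  imports "HOL-Analysis.Analysis"
begin

text \<open>
  Elements of \<open>L\<^sup>2(\<real>\<^sup>d)\<close> are represented by functions rather than by classes modulo
  almost-everywhere equality. The norm is thus only a seminorm on \<open>L2\<close>, but all notions below
  that are built from \<open>inner_L2\<close> and \<open>norm_L2\<close> do not depend on the representatives.
\<close>

definition L2 :: "(real ^ 'd \<Rightarrow> complex) set" where
  "L2 = {f. f \<in> borel_measurable lebesgue \<and> integrable lebesgue (\<lambda>x. (cmod (f x))\<^sup>2)}"

definition inner_L2 :: "(real ^ 'd \<Rightarrow> complex) \<Rightarrow> (real ^ 'd \<Rightarrow> complex) \<Rightarrow> complex" where
  "inner_L2 f g = (LINT x|lebesgue. f x * cnj (g x))"

definition norm_L2 :: "(real ^ 'd \<Rightarrow> complex) \<Rightarrow> real" where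
  "norm_L2 f = sqrt (LINT x|lebesgue. (cmod (f x))\<^sup>2)"

text \<open>
  The summability clause is not redundant: \<open>infsum\<close> is \<open>0\<close> for non-summable families, so without
  it the upper frame inequality would hold vacuously for them.
\<close>

definition frame_bounds :: "'k set \<Rightarrow> ('k \<Rightarrow> real ^ 'd \<Rightarrow> complex) \<Rightarrow> real \<Rightarrow> real \<Rightarrow> bool" where
  "frame_bounds K \<phi> A B \<longleftrightarrow>
     A > 0 \<and> B > 0 \<and> (\<forall>k\<in>K. \<phi> k \<in> L2) \<and>
     (\<forall>f\<in>L2. (\<lambda>k. (cmod (inner_L2 f (\<phi> k)))\<^sup>2) summable_on K \<and>
        A * (norm_L2 f)\<^sup>2 \<le> (\<Sum>\<^sub>\<infinity>k\<in>K. (cmod (inner_L2 f (\<phi> k)))\<^sup>2) \<and>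
        (\<Sum>\<^sub>\<infinity>k\<in>K. (cmod (inner_L2 f (\<phi> k)))\<^sup>2) \<le> B * (norm_L2 f)\<^sup>2)"

definition is_frame :: "'k set \<Rightarrow> ('k \<Rightarrow> real ^ 'd \<Rightarrow> complex) \<Rightarrow> bool" where
  "is_frame K \<phi> \<longleftrightarrow> (\<exists>A B. frame_bounds K \<phi> A B)"

definition lower_frame_bound :: "'k set \<Rightarrow> ('k \<Rightarrow> real ^ 'd \<Rightarrow> complex) \<Rightarrow> real \<Rightarrow> bool" where
  "lower_frame_bound K \<phi> A \<longleftrightarrow> (\<exists>B. frame_bounds K \<phi> A B)"

text \<open>Sequences indexed by \<open>F\<close> are extended by \<open>0\<close> outside \<open>F\<close>, so that equality of functions
  is equality in \<open>\<ell>\<^sup>2(F)\<close>.\<close>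

definition ell2 :: "'i set \<Rightarrow> ('i \<Rightarrow> complex) set" where
  "ell2 F = {c. (\<forall>i. i \<notin> F \<longrightarrow> c i = 0) \<and> (\<lambda>i. (cmod (c i))\<^sup>2) summable_on F}"

definition inner_ell2 :: "'i set \<Rightarrow> ('i \<Rightarrow> complex) \<Rightarrow> ('i \<Rightarrow> complex) \<Rightarrow> complex" where
  "inner_ell2 F c d = (\<Sum>\<^sub>\<infinity>i\<in>F. c i * cnj (d i))"

definition norm_ell2 :: "'i set \<Rightarrow> ('i \<Rightarrow> complex) \<Rightarrow> real" where
  "norm_ell2 F c = sqrt (\<Sum>\<^sub>\<infinity>i\<in>F. (cmod (c i))\<^sup>2)"

definition bounded_linear_ell2 ::
    "'i set \<Rightarrow> 'j set \<Rightarrow> (('i \<Rightarrow> complex) \<Rightarrow> ('j \<Rightarrow> complex)) \<Rightarrow> bool" where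
  "bounded_linear_ell2 F G L \<longleftrightarrow>
     (\<forall>c\<in>ell2 F. L c \<in> ell2 G) \<and>
     (\<forall>c\<in>ell2 F. \<forall>d\<in>ell2 F. L (\<lambda>i. c i + d i) = (\<lambda>j. L c j + L d j)) \<and>
     (\<forall>a. \<forall>c\<in>ell2 F. L (\<lambda>i. a * c i) = (\<lambda>j. a * L c j)) \<and>
     (\<exists>M. \<forall>c\<in>ell2 F. norm_ell2 G (L c) \<le> M * norm_ell2 F c)"

text \<open>The Riesz representative of \<open>c \<mapsto> \<langle>L c, d\<rangle>\<close>; it exists and is unique for \<open>d \<in> \<ell>\<^sup>2(G)\<close>
  and bounded linear \<open>L\<close>.\<close>

definition adjoint_ell2 ::
    "'i set \<Rightarrow> 'j set \<Rightarrow> (('i \<Rightarrow> complex) \<Rightarrow> ('j \<Rightarrow> complex)) \<Rightarrow> (('j \<Rightarrow> complex) \<Rightarrow> ('i \<Rightarrow> complex))"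
  where
  "adjoint_ell2 F G L d =
     (THE e. e \<in> ell2 F \<and> (\<forall>c\<in>ell2 F. inner_ell2 G (L c) d = inner_ell2 F c e))"

text \<open>Only meaningful for finite \<open>F\<close>: the sum is a pointwise finite sum.\<close>

definition synthesis ::
    "'i set \<Rightarrow> ('i \<Rightarrow> real ^ 'd \<Rightarrow> complex) \<Rightarrow> ('i \<Rightarrow> complex) \<Rightarrow> (real ^ 'd \<Rightarrow> complex)" where
  "synthesis F \<phi> c = (\<lambda>x. \<Sum>i\<in>F. c i * \<phi> i x)"

text \<open>Operator norm of \<open>T\<close> on the space \<open>V\<close>, for norms \<open>nV\<close> on \<open>V\<close> and \<open>nW\<close> on the target.
  Using the closed unit ball instead of the unit sphere makes it \<open>0\<close> when \<open>V\<close> is trivial.\<close>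

definition op_norm :: "'v set \<Rightarrow> ('v \<Rightarrow> real) \<Rightarrow> ('w \<Rightarrow> real) \<Rightarrow> ('v \<Rightarrow> 'w) \<Rightarrow> real" where
  "op_norm V nV nW T = (SUP v\<in>{v\<in>V. nV v \<le> 1}. nW (T v))"

end

theory Submission
  imports Defs
begin

text \<open>
  For \<open>f \<in> L\<^sup>2\<close> let \<open>u\<close> and \<open>d\<close> be the coefficient vectors of \<open>f\<close> along \<open>(g\<^sub>i)\<close>, \<open>i \<in> F1\<close>, and
  \<open>(h\<^sub>j)\<close>, \<open>j \<in> F2\<close>, let \<open>K\<close> be the difference of the synthesis operators, and put
  \<open>w = u - L\<^sup>* d = K\<^sup>* f\<close>. Then \<open>\<parallel>w\<parallel>\<^sup>2 = \<langle>K w, f\<rangle> \<le> \<parallel>K\<parallel> \<parallel>w\<parallel> \<parallel>f\<parallel>\<close>, so \<open>\<parallel>w\<parallel>\<^sup>2 \<le> C \<parallel>f\<parallel>\<^sup>2\<close> and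
  \<open>\<parallel>u\<parallel>\<^sup>2 \<le> 2 C \<parallel>f\<parallel>\<^sup>2 + 2 \<parallel>L\<^sup>*\<parallel>\<^sup>2 \<parallel>d\<parallel>\<^sup>2\<close>. Inserting this into the lower frame inequality of \<open>(g\<^sub>i)\<close>
  replaces the coefficients indexed by \<open>F1\<close> by those of the \<open>h\<^sub>j\<close>.
\<close>

section \<open>Square-integrable functions and the Cauchy-Schwarz inequality\<close>

lemma L2_measurable: "f \<in> L2 \<Longrightarrow> f \<in> borel_measurable lebesgue"
  and L2_integrable: "f \<in> L2 \<Longrightarrow> integrable lebesgue (\<lambda>x. (cmod (f x))\<^sup>2)"
  by (simp_all add: L2_def)

lemma norm_L2_nonneg: "norm_L2 f \<ge> 0"
  by (simp add: norm_L2_def)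

lemma norm_L2_squared: "(norm_L2 f)\<^sup>2 = (LINT x|lebesgue. (cmod (f x))\<^sup>2)"
  by (simp add: norm_L2_def)

text \<open>Domination by the sum of the squares. Integrability has to be known before integrals of
  products are split, since a non-integrable function has integral \<open>0\<close> by
  default.\<close>

lemma L2_integrable_prod_norm:
  assumes "f \<in> L2" "g \<in> L2"
  shows "integrable lebesgue (\<lambda>x. cmod (f x) * cmod (g x))"
proof (rule Bochner_Integration.integrable_bound)
  show "integrable lebesgue (\<lambda>x. (cmod (f x))\<^sup>2 + (cmod (g x))\<^sup>2)"
    using assms by (intro Bochner_Integration.integrable_add L2_integrable)
  show "(\<lambda>x. cmod (f x) * cmod (g x)) \<in> borel_measurable lebesgue"
    using assms[THEN L2_measurable] by measurable
  have "cmod (f x) * cmod (g x) \<le> (cmod (f x))\<^sup>2 + (cmod (g x))\<^sup>2" for x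
    using sum_squares_bound[of "cmod (f x)" "cmod (g x)"]
      mult_nonneg_nonneg[of "cmod (f x)" "cmod (g x)"] norm_ge_zero[of "f x"] norm_ge_zero[of "g x"]
    by linarith
  then show "AE x in lebesgue. norm (cmod (f x) * cmod (g x))
      \<le> norm ((cmod (f x))\<^sup>2 + (cmod (g x))\<^sup>2)"
    by simp
qed

lemma L2_integrable_prod:
  assumes "f \<in> L2" "g \<in> L2"
  shows "integrable lebesgue (\<lambda>x. f x * cnj (g x))"
proof (rule Bochner_Integration.integrable_bound[OF L2_integrable_prod_norm[OF assms]])
  have "(\<lambda>x. cnj (g x)) \<in> borel_measurable lebesgue"
    using continuous_on_cnj[OF continuous_on_id] L2_measurable[OF assms(2)]
    by (rule borel_measurable_continuous_on)
  then show "(\<lambda>x. f x * cnj (g x)) \<in> borel_measurable lebesgue"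
    using L2_measurable[OF assms(1)] by (intro borel_measurable_times)
qed (simp add: norm_mult)

lemma inner_L2_commute: "inner_L2 f g = cnj (inner_L2 g f)"
proof -
  have "cnj (inner_L2 g f) = (LINT x|lebesgue. cnj (g x * cnj (f x)))"
    unfolding inner_L2_def by (rule Bochner_Integration.integral_cnj[symmetric])
  also have "\<dots> = inner_L2 f g"
    unfolding inner_L2_def by (rule Bochner_Integration.integral_cong) simp_all
  finally show ?thesis
    by (rule sym)
qed

text \<open>The discriminant argument in homogeneous form: two parameters \<open>s\<close>,
  \<open>t\<close> avoid dividing by \<open>b\<close>, which may vanish because
  \<open>norm_L2\<close> is only a seminorm.\<close>

lemma cauchy_schwarz_from_quadratic_form:
  fixes a b p :: real
  assumes "\<And>s t. 0 \<le> s\<^sup>2 * a - 2 * s * t * p + t\<^sup>2 * b"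
  shows "p\<^sup>2 \<le> a * b"
proof (cases "b = 0")
  case True
  have "p = 0"
  proof (rule ccontr)
    assume "p \<noteq> 0"
    then show False
      \<comment> \<open>For \<open>b = 0\<close> the form is affine in \<open>t\<close>; this
        \<open>t\<close> gives it the value \<open>-1\<close>.\<close>
      using assms[of 1 "(a + 1) / (2 * p)"] True by simp
  qed
  then show ?thesis
    using True by simp
next
  case False
  with assms[of 0 1] have "b > 0"
    by simp
  moreover have "0 \<le> b * (a * b - p\<^sup>2)"
    using assms[of b p] by (simp add: power2_eq_square algebra_simps)
  ultimately show ?thesis
    by (simp add: zero_le_mult_iff)
qed

text \<open>The quadratic form is the integral of \<open>(s |f| - t |g|)^2\<close>. Working with
  moduli keeps it real and bounds even the integral \<open>p\<close> of \<open>|f| |g|\<close>,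
  which dominates the modulus of the inner product.\<close>

lemma inner_L2_Cauchy_Schwarz:
  assumes "f \<in> L2" "g \<in> L2"
  shows "cmod (inner_L2 f g) \<le> norm_L2 f * norm_L2 g"
proof -
  define p where "p = (LINT x|lebesgue. cmod (f x) * cmod (g x))"
  have "0 \<le> s\<^sup>2 * (norm_L2 f)\<^sup>2 - 2 * s * t * p + t\<^sup>2 * (norm_L2 g)\<^sup>2" for s t
  proof -
    have "0 \<le> (LINT x|lebesgue. (s * cmod (f x) - t * cmod (g x))\<^sup>2)"
      by simp
    also have "\<dots> = (LINT x|lebesgue. s\<^sup>2 * (cmod (f x))\<^sup>2
        - 2 * s * t * (cmod (f x) * cmod (g x)) + t\<^sup>2 * (cmod (g x))\<^sup>2)"
      by (rule Bochner_Integration.integral_cong)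
        (simp_all add: power2_eq_square algebra_simps)
    also have "\<dots> = s\<^sup>2 * (norm_L2 f)\<^sup>2 - 2 * s * t * p + t\<^sup>2 * (norm_L2 g)\<^sup>2"
      using assms[THEN L2_integrable] L2_integrable_prod_norm[OF assms]
      by (simp add: norm_L2_squared p_def)
    finally show ?thesis .
  qed
  then have "p\<^sup>2 \<le> (norm_L2 f * norm_L2 g)\<^sup>2"
    using cauchy_schwarz_from_quadratic_form by (simp add: power_mult_distrib)
  then have "p \<le> norm_L2 f * norm_L2 g"
    by (rule power2_le_imp_le) (simp add: norm_L2_nonneg)
  moreover have "cmod (inner_L2 f g) \<le> p"
    unfolding inner_L2_def p_def
    by (rule order_trans[OF integral_norm_bound]) (simp add: norm_mult)
  ultimately show ?thesis
    by simp
qed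

lemma norm_L2_scale: "norm_L2 (\<lambda>x. a * f x) = cmod a * norm_L2 f"
  by (simp add: norm_L2_def norm_mult power_mult_distrib real_sqrt_mult)

section \<open>Sequence spaces over finite index sets and operator norms\<close>

lemma ell2_finite: "finite F \<Longrightarrow> ell2 F = {c. \<forall>i. i \<notin> F \<longrightarrow> c i = 0}"
  by (auto simp: ell2_def)

lemma norm_ell2_finite: "finite F \<Longrightarrow> norm_ell2 F c = L2_set (\<lambda>i. cmod (c i)) F"
  by (simp add: norm_ell2_def L2_set_def)

lemma norm_ell2_squared: "finite F \<Longrightarrow> (norm_ell2 F c)\<^sup>2 = (\<Sum>i\<in>F. (cmod (c i))\<^sup>2)"
  by (simp add: norm_ell2_def sum_nonneg)

lemma norm_ell2_nonneg: "finite F \<Longrightarrow> norm_ell2 F c \<ge> 0"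
  by (simp add: norm_ell2_finite)

lemma norm_ell2_scale: "finite F \<Longrightarrow> norm_ell2 F (\<lambda>i. a * c i) = cmod a * norm_ell2 F c"
  by (simp add: norm_ell2_def norm_mult power_mult_distrib real_sqrt_mult flip: sum_distrib_left)

lemma inner_ell2_finite: "finite F \<Longrightarrow> inner_ell2 F c d = (\<Sum>i\<in>F. c i * cnj (d i))"
  by (simp add: inner_ell2_def)

lemma inner_ell2_scale_right:
  "finite F \<Longrightarrow> inner_ell2 F c (\<lambda>i. a * d i) = cnj a * inner_ell2 F c d"
  by (simp add: inner_ell2_finite sum_distrib_left mult_ac)

lemma inner_ell2_self: "finite F \<Longrightarrow> inner_ell2 F c c = of_real ((norm_ell2 F c)\<^sup>2)"
  by (simp add: inner_ell2_finite norm_ell2_squared complex_norm_square del: of_real_power)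

lemma inner_ell2_Cauchy_Schwarz:
  assumes "finite F"
  shows "cmod (inner_ell2 F c d) \<le> norm_ell2 F c * norm_ell2 F d"
proof -
  have "cmod (inner_ell2 F c d) \<le> (\<Sum>i\<in>F. \<bar>cmod (c i)\<bar> * \<bar>cmod (d i)\<bar>)"
    using assms by (simp add: inner_ell2_finite sum_norm_le norm_mult)
  also have "\<dots> \<le> norm_ell2 F c * norm_ell2 F d"
    using L2_set_mult_ineq assms by (simp only: norm_ell2_finite)
  finally show ?thesis .
qed

text \<open>Testing against unit vectors recovers the coordinates in \<open>F\<close>; outside
  \<open>F\<close> both vectors vanish. This gives the uniqueness behind the definite description in
  \<open>adjoint_ell2\<close>.\<close>

lemma ell2_eqI:
  assumes "finite F" "e \<in> ell2 F" "e' \<in> ell2 F"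
    and eq: "\<And>c. c \<in> ell2 F \<Longrightarrow> inner_ell2 F c e = inner_ell2 F c e'"
  shows "e = e'"
proof
  fix i
  show "e i = e' i"
  proof (cases "i \<in> F")
    case True
    have "(\<lambda>k. if k = i then 1 else 0) \<in> ell2 F"
      using True assms(1) by (simp add: ell2_finite)
    from eq[OF this] show ?thesis
      using True assms(1) by (simp add: inner_ell2_finite if_distrib[of "\<lambda>x. x * _"] cong: if_cong)
  qed (use assms in \<open>simp add: ell2_finite\<close>)
qed

text \<open>Normalising \<open>v\<close> puts it into the unit ball. Some a priori bound
  \<open>M\<close> is required because a supremum of reals is meaningful only for a set bounded
  above. A \<open>v\<close> with \<open>nV v = 0\<close> cannot be normalised, but there
  \<open>M\<close> already forces \<open>nW (T v) = 0\<close>.\<close>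

lemma op_norm_bound:
  fixes V :: "('a \<Rightarrow> complex) set" and T :: "('a \<Rightarrow> complex) \<Rightarrow> 'b \<Rightarrow> complex"
  assumes bound: "\<And>v. v \<in> V \<Longrightarrow> nW (T v) \<le> M * nV v"
    and scale: "\<And>a v. v \<in> V \<Longrightarrow> (\<lambda>i. a * v i) \<in> V"
    and nV: "\<And>a v. nV (\<lambda>i. a * v i) = cmod a * nV v" "\<And>v. nV v \<ge> 0"
    and nW: "\<And>a w. nW (\<lambda>i. a * w i) = cmod a * nW w" "\<And>w. nW w \<ge> 0"
    and T: "\<And>a v. v \<in> V \<Longrightarrow> T (\<lambda>i. a * v i) = (\<lambda>i. a * T v i)"
    and v: "v \<in> V"
  shows "nW (T v) \<le> op_norm V nV nW T * nV v"
proof (cases "nV v = 0")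
  case True
  with bound[OF v] nW(2)[of "T v"] show ?thesis
    by simp
next
  case False
  with nV(2)[of v] have pos: "nV v > 0"
    by simp
  define a where "a = complex_of_real (1 / nV v)"
  have a: "cmod a = 1 / nV v"
    using pos unfolding a_def norm_of_real by simp
  have "nW (T u) \<le> \<bar>M\<bar>" if "u \<in> V" "nV u \<le> 1" for u
  proof -
    have "nW (T u) \<le> \<bar>M\<bar> * nV u"
      using bound[OF that(1)] mult_right_mono[OF abs_ge_self[of M] nV(2)[of u]] by linarith
    also have "\<dots> \<le> \<bar>M\<bar> * 1"
      using that(2) by (intro mult_left_mono) auto
    finally show ?thesis by simp
  qed
  then have "bdd_above ((\<lambda>u. nW (T u)) ` {u \<in> V. nV u \<le> 1})"
    by (intro bdd_aboveI2[where M = "\<bar>M\<bar>"]) auto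
  then have "nW (T (\<lambda>i. a * v i)) \<le> op_norm V nV nW T"
    unfolding op_norm_def using v scale pos
    by (intro cSUP_upper) (simp_all add: nV a)
  then show ?thesis
    using pos v by (simp add: T nW a field_simps)
qed

section \<open>Bounded linear maps between finite sequence spaces and their adjoints\<close>

lemma bounded_linear_ell2_bound:
  assumes "bounded_linear_ell2 F G L" "finite F"
  obtains M where "M \<ge> 0" "\<And>c. c \<in> ell2 F \<Longrightarrow> norm_ell2 G (L c) \<le> M * norm_ell2 F c"
proof -
  obtain M where M: "norm_ell2 G (L c) \<le> M * norm_ell2 F c" if "c \<in> ell2 F" for c
    using assms(1) unfolding bounded_linear_ell2_def by blast
  show thesis
  proof (rule that)
    show "norm_ell2 G (L c) \<le> \<bar>M\<bar> * norm_ell2 F c" if "c \<in> ell2 F" for c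
      using M[OF that] mult_right_mono[OF abs_ge_self[of M] norm_ell2_nonneg[OF assms(2), of c]]
      by linarith
  qed simp
qed

lemma bounded_linear_ell2_expand:
  assumes L: "bounded_linear_ell2 F G L" and "finite F" and c: "c \<in> ell2 F"
  shows "L c = (\<lambda>j. \<Sum>i\<in>F. c i * L (\<lambda>k. if k = i then 1 else 0) j)"
proof -
  define \<delta> :: "'a \<Rightarrow> 'a \<Rightarrow> complex" where "\<delta> i = (\<lambda>k. if k = i then 1 else 0)" for i
  have \<delta>: "\<delta> i \<in> ell2 F" if "i \<in> F" for i
    using that \<open>finite F\<close> by (auto simp: \<delta>_def ell2_finite)
  have scale: "L (\<lambda>k. a * x k) = (\<lambda>j. a * L x j)" if "x \<in> ell2 F" for a x
    using L that unfolding bounded_linear_ell2_def by blast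
  have add: "L (\<lambda>k. x k + y k) = (\<lambda>j. L x j + L y j)" if "x \<in> ell2 F" "y \<in> ell2 F" for x y
    using L that unfolding bounded_linear_ell2_def by blast
  have zero: "L (\<lambda>k. 0) = (\<lambda>j. 0)"
    using scale[of "\<lambda>k. 0" 0] \<open>finite F\<close> by (simp add: ell2_finite)
  \<comment> \<open>Additivity of \<open>L\<close> is available only for two summands in
    \<open>ell2 F\<close>; induction over subsets of \<open>F\<close> keeps every partial sum in
    that space.\<close>
  have "L (\<lambda>k. \<Sum>i\<in>S. c i * \<delta> i k) = (\<lambda>j. \<Sum>i\<in>S. c i * L (\<delta> i) j)" if "S \<subseteq> F" for S
    using finite_subset[OF that \<open>finite F\<close>] that
  proof (induction S rule: finite_induct)
    case (insert i S)
    have "(\<lambda>k. c i * \<delta> i k) \<in> ell2 F" "(\<lambda>k. \<Sum>i\<in>S. c i * \<delta> i k) \<in> ell2 F"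
      using insert.prems \<delta> \<open>finite F\<close> by (auto simp: ell2_finite subset_iff intro!: sum.neutral)
    from add[OF this] show ?case
      using insert by (simp add: scale[OF \<delta>])
  qed (simp add: zero)
  moreover have "(\<lambda>k. \<Sum>i\<in>F. c i * \<delta> i k) = c"
    using c \<open>finite F\<close>
    by (auto simp: \<delta>_def ell2_finite if_distrib[of "\<lambda>x. _ * x"] cong: if_cong)
  ultimately show ?thesis
    using \<delta>_def by (metis (no_types, lifting) order_refl sum.cong)
qed

lemma adjoint_ell2_unique:
  assumes "finite F" "e \<in> ell2 F"
    and "\<And>c. c \<in> ell2 F \<Longrightarrow> inner_ell2 G (L c) d = inner_ell2 F c e"
  shows "adjoint_ell2 F G L d = e"
  unfolding adjoint_ell2_def
proof (rule the_equality)
  fix e'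
  assume "e' \<in> ell2 F \<and> (\<forall>c\<in>ell2 F. inner_ell2 G (L c) d = inner_ell2 F c e')"
  then show "e' = e"
    using assms by (intro ell2_eqI[of F]) auto
qed (use assms in auto)

text \<open>Existence of the Riesz representative by an explicit formula. Only the values of
  \<open>d\<close> on \<open>G\<close> enter, so \<open>d\<close> may be any function.\<close>

lemma adjoint_ell2:
  assumes L: "bounded_linear_ell2 F G L" and fin: "finite F" "finite G"
  shows "adjoint_ell2 F G L d \<in> ell2 F"
    and "c \<in> ell2 F \<Longrightarrow> inner_ell2 G (L c) d = inner_ell2 F c (adjoint_ell2 F G L d)"
proof -
  define \<delta> :: "'a \<Rightarrow> 'a \<Rightarrow> complex" where "\<delta> i = (\<lambda>k. if k = i then 1 else 0)" for i
  \<comment> \<open>Testing the adjoint identity with the unit vector \<open>\<delta> i\<close>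
    forces this value.\<close>
  define e where "e i = (if i \<in> F then cnj (inner_ell2 G (L (\<delta> i)) d) else 0)" for i
  have e: "e \<in> ell2 F"
    using fin by (simp add: e_def ell2_finite)
  have inner: "inner_ell2 G (L c) d = inner_ell2 F c e" if "c \<in> ell2 F" for c
  proof -
    have "inner_ell2 G (L c) d = (\<Sum>j\<in>G. (\<Sum>i\<in>F. c i * L (\<delta> i) j) * cnj (d j))"
      using fin by (subst bounded_linear_ell2_expand[OF L fin(1) that])
        (simp add: inner_ell2_finite \<delta>_def)
    also have "\<dots> = (\<Sum>i\<in>F. c i * (\<Sum>j\<in>G. L (\<delta> i) j * cnj (d j)))"
      by (simp add: sum_distrib_left sum_distrib_right mult.assoc) (rule sum.swap)
    also have "\<dots> = inner_ell2 F c e"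
      using fin by (simp add: inner_ell2_finite e_def)
    finally show ?thesis .
  qed
  have "adjoint_ell2 F G L d = e"
    using fin(1) e inner by (rule adjoint_ell2_unique)
  then show "adjoint_ell2 F G L d \<in> ell2 F"
    and "c \<in> ell2 F \<Longrightarrow> inner_ell2 G (L c) d = inner_ell2 F c (adjoint_ell2 F G L d)"
    using e inner by auto
qed

lemma adjoint_ell2_scale:
  assumes "bounded_linear_ell2 F G L" "finite F" "finite G"
  shows "adjoint_ell2 F G L (\<lambda>j. a * d j) = (\<lambda>i. a * adjoint_ell2 F G L d i)"
proof (rule adjoint_ell2_unique)
  show "(\<lambda>i. a * adjoint_ell2 F G L d i) \<in> ell2 F"
    using adjoint_ell2(1)[OF assms] assms by (simp add: ell2_finite)
  fix c assume "c \<in> ell2 F"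
  then show "inner_ell2 G (L c) (\<lambda>j. a * d j)
      = inner_ell2 F c (\<lambda>i. a * adjoint_ell2 F G L d i)"
    using adjoint_ell2(2)[OF assms, of c d] assms(2,3)
    by (simp add: inner_ell2_scale_right)
qed (use assms in simp)

text \<open>Any bound \<open>M\<close> for \<open>L\<close> also bounds its adjoint, so the supremum
  defining the operator norm is finite and \<open>op_norm_bound\<close> applies.\<close>

lemma norm_adjoint_ell2_le:
  assumes L: "bounded_linear_ell2 F G L" and fin: "finite F" "finite G" and d: "d \<in> ell2 G"
  shows "norm_ell2 F (adjoint_ell2 F G L d)
    \<le> op_norm (ell2 G) (norm_ell2 G) (norm_ell2 F) (adjoint_ell2 F G L) * norm_ell2 G d"
proof -
  obtain M where M: "M \<ge> 0" "\<And>c. c \<in> ell2 F \<Longrightarrow> norm_ell2 G (L c) \<le> M * norm_ell2 F c"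
    using bounded_linear_ell2_bound[OF L fin(1)] by blast
  have "norm_ell2 F (adjoint_ell2 F G L v) \<le> M * norm_ell2 G v" for v
  proof -
    define e where "e = adjoint_ell2 F G L v"
    have e: "e \<in> ell2 F"
      using adjoint_ell2(1)[OF L fin] by (simp add: e_def)
    \<comment> \<open>The adjoint identity is tested with \<open>c = e\<close>. Cauchy-Schwarz then
      leaves a factor \<open>norm_ell2 F e\<close> on both sides, to be cancelled.\<close>
    have "complex_of_real ((norm_ell2 F e)\<^sup>2) = inner_ell2 G (L e) v"
      using adjoint_ell2(2)[OF L fin e] fin by (simp only: inner_ell2_self flip: e_def)
    then have "(norm_ell2 F e)\<^sup>2 = cmod (inner_ell2 G (L e) v)"
      by (metis abs_of_nonneg norm_of_real zero_le_power2)
    also have "\<dots> \<le> norm_ell2 G (L e) * norm_ell2 G v"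
      using fin(2) by (rule inner_ell2_Cauchy_Schwarz)
    also have "\<dots> \<le> M * norm_ell2 F e * norm_ell2 G v"
      using M(2)[OF e] fin by (intro mult_right_mono norm_ell2_nonneg)
    finally have "norm_ell2 F e * norm_ell2 F e \<le> norm_ell2 F e * (M * norm_ell2 G v)"
      by (simp add: power2_eq_square mult_ac)
    moreover have "0 \<le> M * norm_ell2 G v"
      using M(1) fin by (simp add: norm_ell2_nonneg)
    ultimately show ?thesis
      using norm_ell2_nonneg[OF fin(1), of e] unfolding e_def[symmetric]
      by (cases "norm_ell2 F e = 0") (auto simp: mult_le_cancel_left)
  qed
  then show ?thesis
    using fin d
    by (intro op_norm_bound[where M = M])
      (auto simp: norm_ell2_nonneg norm_ell2_scale adjoint_ell2_scale[OF L fin] ell2_finite)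
qed

section \<open>Norm bounds for synthesis operators\<close>

lemma L2_sum:
  fixes \<phi> :: "'k \<Rightarrow> real ^ 'd \<Rightarrow> complex"
  assumes "finite F" "\<And>k. k \<in> F \<Longrightarrow> \<phi> k \<in> L2"
  shows "(\<lambda>x. \<Sum>k\<in>F. c k * \<phi> k x) \<in> L2"
    and "norm_L2 (\<lambda>x. \<Sum>k\<in>F. c k * \<phi> k x)
      \<le> norm_ell2 F c * sqrt (\<Sum>k\<in>F. (norm_L2 (\<phi> k))\<^sup>2)"
proof -
  \<comment> \<open>Cauchy-Schwarz in the index \<open>k\<close> at each point \<open>x\<close>.
    Integrating over \<open>x\<close> yields both membership in \<open>L2\<close> and the norm
    bound.\<close>
  have pointwise: "(cmod (\<Sum>k\<in>F. c k * \<phi> k x))\<^sup>2 \<le> (norm_ell2 F c)\<^sup>2 * (\<Sum>k\<in>F. (cmod (\<phi> k x))\<^sup>2)" for x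
  proof -
    have "cmod (\<Sum>k\<in>F. c k * \<phi> k x) \<le> norm_ell2 F c * norm_ell2 F (\<lambda>k. cnj (\<phi> k x))"
      using inner_ell2_Cauchy_Schwarz[OF assms(1), of c "\<lambda>k. cnj (\<phi> k x)"] assms(1)
      by (simp add: inner_ell2_finite)
    then have "(cmod (\<Sum>k\<in>F. c k * \<phi> k x))\<^sup>2 \<le> (norm_ell2 F c * norm_ell2 F (\<lambda>k. cnj (\<phi> k x)))\<^sup>2"
      by (simp add: power_mono)
    then show ?thesis
      using assms(1) by (simp add: power_mult_distrib norm_ell2_squared)
  qed
  have int: "integrable lebesgue (\<lambda>x. (norm_ell2 F c)\<^sup>2 * (\<Sum>k\<in>F. (cmod (\<phi> k x))\<^sup>2))"
    using assms by (intro integrable_mult_right Bochner_Integration.integrable_sum L2_integrable)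
  have meas: "(\<lambda>x. \<Sum>k\<in>F. c k * \<phi> k x) \<in> borel_measurable lebesgue"
    using assms(2)[THEN L2_measurable]
    by (intro borel_measurable_sum borel_measurable_times[OF borel_measurable_const])
  have int': "integrable lebesgue (\<lambda>x. (cmod (\<Sum>k\<in>F. c k * \<phi> k x))\<^sup>2)"
  proof (rule Bochner_Integration.integrable_bound[OF int])
    show "(\<lambda>x. (cmod (\<Sum>k\<in>F. c k * \<phi> k x))\<^sup>2) \<in> borel_measurable lebesgue"
      using meas by measurable
    show "AE x in lebesgue. norm ((cmod (\<Sum>k\<in>F. c k * \<phi> k x))\<^sup>2)
        \<le> norm ((norm_ell2 F c)\<^sup>2 * (\<Sum>k\<in>F. (cmod (\<phi> k x))\<^sup>2))"
      using pointwise by (intro AE_I2) (simp add: sum_nonneg)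
  qed
  show "(\<lambda>x. \<Sum>k\<in>F. c k * \<phi> k x) \<in> L2"
    using meas int' by (simp add: L2_def)
  have "(norm_L2 (\<lambda>x. \<Sum>k\<in>F. c k * \<phi> k x))\<^sup>2
      \<le> (LINT x|lebesgue. (norm_ell2 F c)\<^sup>2 * (\<Sum>k\<in>F. (cmod (\<phi> k x))\<^sup>2))"
    unfolding norm_L2_squared using int' int pointwise by (intro integral_mono) auto
  also have "\<dots> = (norm_ell2 F c)\<^sup>2 * (\<Sum>k\<in>F. (norm_L2 (\<phi> k))\<^sup>2)"
    using L2_integrable[OF assms(2)] by (simp add: norm_L2_squared)
  also have "\<dots> = (norm_ell2 F c * sqrt (\<Sum>k\<in>F. (norm_L2 (\<phi> k))\<^sup>2))\<^sup>2"
    by (simp add: power_mult_distrib sum_nonneg)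
  finally show "norm_L2 (\<lambda>x. \<Sum>k\<in>F. c k * \<phi> k x)
      \<le> norm_ell2 F c * sqrt (\<Sum>k\<in>F. (norm_L2 (\<phi> k))\<^sup>2)"
    by (rule power2_le_imp_le) (simp add: assms(1) sum_nonneg norm_ell2_nonneg)
qed

lemma synthesis_in_L2:
  assumes "finite F" "\<And>k. k \<in> F \<Longrightarrow> \<phi> k \<in> L2"
  shows "synthesis F \<phi> c \<in> L2"
  unfolding synthesis_def using L2_sum(1)[OF assms] .

lemma inner_L2_synthesis:
  assumes "finite F" "\<And>k. k \<in> F \<Longrightarrow> \<phi> k \<in> L2" "f \<in> L2"
  shows "inner_L2 (synthesis F \<phi> c) f = inner_ell2 F c (\<lambda>k. inner_L2 f (\<phi> k))"
proof -
  have "inner_L2 (synthesis F \<phi> c) f = (LINT x|lebesgue. (\<Sum>k\<in>F. c k * (\<phi> k x * cnj (f x))))"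
    by (simp add: inner_L2_def synthesis_def sum_distrib_right mult.assoc)
  also have "\<dots> = (\<Sum>k\<in>F. c k * inner_L2 (\<phi> k) f)"
    using assms by (simp add: inner_L2_def L2_integrable_prod)
  also have "\<dots> = inner_ell2 F c (\<lambda>k. inner_L2 f (\<phi> k))"
    using assms(1) by (simp add: inner_ell2_finite flip: inner_L2_commute)
  finally show ?thesis .
qed

text \<open>The case of \<open>L2_sum\<close> with two summands, indexed by \<open>bool\<close> with
  coefficients \<open>1\<close> and \<open>-1\<close>. The constant \<open>2\<close> is crude, but
  the estimate only serves to show that an operator norm is finite.\<close>

lemma norm_L2_diff_le:
  assumes f: "f \<in> L2" and g: "g \<in> L2"
  shows "(\<lambda>x. f x - g x) \<in> L2" and "norm_L2 (\<lambda>x. f x - g x) \<le> 2 * (norm_L2 f + norm_L2 g)"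
proof -
  let ?\<phi> = "\<lambda>b. if b then f else g" and ?c = "\<lambda>b. if b then 1 else (-1::complex)"
  have eq: "(\<lambda>x. \<Sum>b\<in>UNIV. ?c b * ?\<phi> b x) = (\<lambda>x. f x - g x)"
    by (simp add: UNIV_bool)
  have L2: "?\<phi> b \<in> L2" for b
    using f g by simp
  show "(\<lambda>x. f x - g x) \<in> L2"
    using L2_sum(1)[of UNIV ?\<phi> ?c] L2 unfolding eq by simp
  have "norm_L2 (\<lambda>x. f x - g x) \<le> sqrt 2 * sqrt ((norm_L2 f)\<^sup>2 + (norm_L2 g)\<^sup>2)"
    using L2_sum(2)[of UNIV ?\<phi> ?c] L2 unfolding eq
    by (simp add: norm_ell2_def UNIV_bool add.commute)
  also have "\<dots> \<le> 2 * (norm_L2 f + norm_L2 g)"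
  proof (rule mult_mono)
    show "sqrt 2 \<le> 2"
      by (rule real_le_lsqrt) auto
    show "sqrt ((norm_L2 f)\<^sup>2 + (norm_L2 g)\<^sup>2) \<le> norm_L2 f + norm_L2 g"
      by (rule sqrt_sum_squares_le_sum) (simp_all add: norm_L2_nonneg)
  qed (simp_all add: norm_L2_nonneg)
  finally show "norm_L2 (\<lambda>x. f x - g x) \<le> 2 * (norm_L2 f + norm_L2 g)" .
qed

lemma synthesis_scale: "synthesis F \<phi> (\<lambda>i. a * c i) = (\<lambda>x. a * synthesis F \<phi> c x)"
  by (simp add: synthesis_def sum_distrib_left mult.assoc)

text \<open>The coarse constant \<open>2 * (a + M * b)\<close> only ensures that the supremum is
  taken over a bounded set; the conclusion itself involves the exact operator norm.\<close>

lemma norm_synthesis_diff_le: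
  assumes L: "bounded_linear_ell2 F G L" and fin: "finite F" "finite G"
    and g: "\<And>i. i \<in> F \<Longrightarrow> g i \<in> L2" and h: "\<And>j. j \<in> G \<Longrightarrow> h j \<in> L2" and c: "c \<in> ell2 F"
  shows "norm_L2 (\<lambda>x. synthesis F g c x - synthesis G h (L c) x)
    \<le> op_norm (ell2 F) (norm_ell2 F) norm_L2
        (\<lambda>c x. synthesis F g c x - synthesis G h (L c) x) * norm_ell2 F c"
proof -
  obtain M where M: "M \<ge> 0" "\<And>c. c \<in> ell2 F \<Longrightarrow> norm_ell2 G (L c) \<le> M * norm_ell2 F c"
    using bounded_linear_ell2_bound[OF L fin(1)] by blast
  define a where "a = sqrt (\<Sum>i\<in>F. (norm_L2 (g i))\<^sup>2)"
  define b where "b = sqrt (\<Sum>j\<in>G. (norm_L2 (h j))\<^sup>2)"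
  have "b \<ge> 0"
    by (simp add: b_def sum_nonneg)
  have "norm_L2 (\<lambda>x. synthesis F g v x - synthesis G h (L v) x) \<le> 2 * (a + M * b) * norm_ell2 F v"
    if "v \<in> ell2 F" for v
  proof -
    have "norm_L2 (\<lambda>x. synthesis F g v x - synthesis G h (L v) x)
        \<le> 2 * (norm_L2 (synthesis F g v) + norm_L2 (synthesis G h (L v)))"
      using fin g h by (intro norm_L2_diff_le synthesis_in_L2)
    moreover have "norm_L2 (synthesis F g v) \<le> norm_ell2 F v * a"
      unfolding synthesis_def a_def using fin g by (intro L2_sum)
    moreover have "norm_L2 (synthesis G h (L v)) \<le> norm_ell2 G (L v) * b"
      unfolding synthesis_def b_def using fin h by (intro L2_sum)
    moreover have "norm_ell2 G (L v) * b \<le> M * norm_ell2 F v * b"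
      using M(2)[OF that] \<open>b \<ge> 0\<close> by (rule mult_right_mono)
    ultimately show ?thesis
      by (simp add: algebra_simps)
  qed
  moreover have "L (\<lambda>i. r * v i) = (\<lambda>j. r * L v j)" if "v \<in> ell2 F" for r v
    using L that unfolding bounded_linear_ell2_def by blast
  ultimately show ?thesis
    using fin c
    by (intro op_norm_bound[where M = "2 * (a + M * b)"
          and T = "\<lambda>c x. synthesis F g c x - synthesis G h (L c) x"])
      (auto simp: norm_ell2_nonneg norm_ell2_scale norm_L2_nonneg norm_L2_scale
        synthesis_scale ell2_finite algebra_simps)
qed

section \<open>Exchanging coefficients along the removed elements for those along the added
  ones\<close>

lemma norm_ell2_add_squared_le:
  assumes "finite F"
  shows "(norm_ell2 F (\<lambda>i. c i + d i))\<^sup>2 \<le> 2 * (norm_ell2 F c)\<^sup>2 + 2 * (norm_ell2 F d)\<^sup>2"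
proof -
  have "(cmod (c i + d i))\<^sup>2 \<le> 2 * (cmod (c i))\<^sup>2 + 2 * (cmod (d i))\<^sup>2" for i
  proof -
    have "(cmod (c i + d i))\<^sup>2 \<le> (cmod (c i) + cmod (d i))\<^sup>2"
      by (simp add: power_mono norm_triangle_ineq)
    also have "\<dots> \<le> 2 * (cmod (c i))\<^sup>2 + 2 * (cmod (d i))\<^sup>2"
      using sum_squares_bound[of "cmod (c i)" "cmod (d i)"] by (simp add: power2_sum)
    finally show ?thesis .
  qed
  then show ?thesis
    using assms
    by (auto simp: norm_ell2_squared sum_distrib_left simp flip: sum.distrib intro!: sum_mono)
qed

text \<open>This is the estimate for \<open>u\<close> from the overview, with \<open>?N\<close> the
  norm of the difference of the synthesis operators and \<open>?P\<close> that of the adjoint of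
  \<open>L\<close>.\<close>

lemma coefficient_exchange:
  assumes L: "bounded_linear_ell2 F G L" and fin: "finite F" "finite G"
    and g: "\<And>i. i \<in> F \<Longrightarrow> g i \<in> L2" and h: "\<And>j. j \<in> G \<Longrightarrow> h j \<in> L2" and f: "f \<in> L2"
  shows "(\<Sum>i\<in>F. (cmod (inner_L2 f (g i)))\<^sup>2)
    \<le> 2 * (op_norm (ell2 F) (norm_ell2 F) norm_L2
            (\<lambda>c x. synthesis F g c x - synthesis G h (L c) x))\<^sup>2 * (norm_L2 f)\<^sup>2
      + 2 * (op_norm (ell2 G) (norm_ell2 G) (norm_ell2 F) (adjoint_ell2 F G L))\<^sup>2
        * (\<Sum>j\<in>G. (cmod (inner_L2 f (h j)))\<^sup>2)"
    (is "_ \<le> 2 * ?N\<^sup>2 * _ + 2 * ?P\<^sup>2 * _")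
proof -
  \<comment> \<open>Both coefficient vectors are cut off to \<open>0\<close> outside the index set,
    as membership in \<open>ell2\<close> demands.\<close>
  define u where "u i = (if i \<in> F then inner_L2 f (g i) else 0)" for i
  define d where "d j = (if j \<in> G then inner_L2 f (h j) else 0)" for j
  define e where "e = adjoint_ell2 F G L d"
  define w where "w = (\<lambda>i. u i - e i)"
  define K where "K = (\<lambda>x. synthesis F g w x - synthesis G h (L w) x)"
  have d: "d \<in> ell2 G"
    using fin by (simp add: d_def ell2_finite)
  have w: "w \<in> ell2 F"
    using fin adjoint_ell2(1)[OF L fin, of d] by (simp add: w_def u_def e_def ell2_finite)
  have K: "K \<in> L2"
    unfolding K_def using fin g h by (intro norm_L2_diff_le synthesis_in_L2)
  \<comment> \<open>This chain says that \<open>w\<close> is the adjoint of the difference operator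
    applied to \<open>f\<close>: \<open>\<langle>K, f\<rangle> = \<langle>w, u\<rangle> - \<langle>L
    w, d\<rangle> = \<langle>w, u - e\<rangle>\<close>.\<close>
  have "inner_L2 K f = inner_L2 (synthesis F g w) f - inner_L2 (synthesis G h (L w)) f"
    using fin g h f
    by (simp add: K_def inner_L2_def left_diff_distrib synthesis_in_L2 L2_integrable_prod)
  also have "\<dots> = inner_ell2 F w u - inner_ell2 G (L w) d"
    using fin g h f by (simp add: inner_L2_synthesis inner_ell2_finite u_def d_def)
  also have "\<dots> = inner_ell2 F w w"
    using adjoint_ell2(2)[OF L fin w, of d] fin
    by (simp add: inner_ell2_finite w_def e_def right_diff_distrib sum_subtractf)
  finally have "inner_L2 K f = complex_of_real ((norm_ell2 F w)\<^sup>2)"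
    using fin by (simp only: inner_ell2_self)
  then have "(norm_ell2 F w)\<^sup>2 = cmod (inner_L2 K f)"
    by (metis abs_of_nonneg norm_of_real zero_le_power2)
  also have "\<dots> \<le> norm_L2 K * norm_L2 f"
    using K f by (rule inner_L2_Cauchy_Schwarz)
  also have "\<dots> \<le> ?N * norm_ell2 F w * norm_L2 f"
    unfolding K_def using L fin g h w
    by (intro mult_right_mono norm_synthesis_diff_le norm_L2_nonneg)
  finally have w_le: "norm_ell2 F w * norm_ell2 F w \<le> norm_ell2 F w * (?N * norm_L2 f)"
    by (simp add: power2_eq_square mult_ac)
  have "(norm_ell2 F w)\<^sup>2 \<le> (?N * norm_L2 f)\<^sup>2"
  proof (cases "norm_ell2 F w = 0")
    case False
    with norm_ell2_nonneg[OF fin(1), of w] w_le have "norm_ell2 F w \<le> ?N * norm_L2 f"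
      by simp
    then show ?thesis
      using fin by (intro power_mono norm_ell2_nonneg)
  qed simp
  moreover have "(norm_ell2 F e)\<^sup>2 \<le> (?P * norm_ell2 G d)\<^sup>2"
    unfolding e_def using L fin d by (intro power_mono norm_adjoint_ell2_le norm_ell2_nonneg)
  \<comment> \<open>The splitting \<open>u = w + e\<close> is the source of both factors
    \<open>2\<close> in the final frame bound.\<close>
  moreover have "(norm_ell2 F u)\<^sup>2 \<le> 2 * (norm_ell2 F w)\<^sup>2 + 2 * (norm_ell2 F e)\<^sup>2"
    using norm_ell2_add_squared_le[OF fin(1), of w e] by (simp add: w_def)
  ultimately have "(norm_ell2 F u)\<^sup>2
      \<le> 2 * ?N\<^sup>2 * (norm_L2 f)\<^sup>2 + 2 * ?P\<^sup>2 * (norm_ell2 G d)\<^sup>2"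
    by (simp add: power_mult_distrib)
  then show ?thesis
    using fin by (simp add: norm_ell2_squared u_def d_def)
qed

section \<open>Sums over a disjoint union and the frame inequalities\<close>

lemma
  fixes p :: "'i + 'j \<Rightarrow> real"
  assumes "(\<lambda>i. p (Inl i)) summable_on A" "(\<lambda>j. p (Inr j)) summable_on B"
  shows summable_on_Plus: "p summable_on (A <+> B)"
    and infsum_Plus: "infsum p (A <+> B) = (\<Sum>\<^sub>\<infinity>i\<in>A. p (Inl i)) + (\<Sum>\<^sub>\<infinity>j\<in>B. p (Inr j))"
proof -
  have *: "p summable_on Inl ` A" "p summable_on Inr ` B" "Inl ` A \<inter> Inr ` B = {}"
    using assms by (auto simp: summable_on_reindex o_def)
  show "p summable_on (A <+> B)"
    unfolding Plus_def using * by (rule summable_on_Un_disjoint)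
  show "infsum p (A <+> B) = (\<Sum>\<^sub>\<infinity>i\<in>A. p (Inl i)) + (\<Sum>\<^sub>\<infinity>j\<in>B. p (Inr j))"
    unfolding Plus_def infsum_Un_disjoint[OF *] by (simp add: infsum_reindex o_def)
qed

theorem theorem3:
  fixes g :: "'i \<Rightarrow> real ^ 'd \<Rightarrow> complex"
    and h :: "'j \<Rightarrow> real ^ 'd \<Rightarrow> complex"
    and I F1 :: "'i set" and J F2 :: "'j set"
    and L :: "('i \<Rightarrow> complex) \<Rightarrow> ('j \<Rightarrow> complex)"
    and A1 C :: real
  assumes "is_frame I g" and "is_frame J h"
    and "lower_frame_bound I g A1"
    and "F1 \<subseteq> I" and "finite F1"
    and "F2 \<subseteq> J" and "finite F2"
    and "bounded_linear_ell2 F1 F2 L"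
    and "(op_norm (ell2 F1) (norm_ell2 F1) norm_L2
            (\<lambda>c x. synthesis F1 g c x - synthesis F2 h (L c) x))\<^sup>2 = C"
    and "C < A1 / 2"
  shows "is_frame ((I - F1) <+> F2) (case_sum g h) \<and>
    lower_frame_bound ((I - F1) <+> F2) (case_sum g h)
      ((A1 - 2 * C) /
        max 1 (2 * (op_norm (ell2 F2) (norm_ell2 F2) (norm_ell2 F1) (adjoint_ell2 F1 F2 L))\<^sup>2))"
proof -
  define P where "P = op_norm (ell2 F2) (norm_ell2 F2) (norm_ell2 F1) (adjoint_ell2 F1 F2 L)"
  define m where "m = max 1 (2 * P\<^sup>2)"
  have m: "m \<ge> 1" "m \<ge> 2 * P\<^sup>2"
    by (simp_all add: m_def)
  obtain B1 where B1: "frame_bounds I g A1 B1"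
    using assms(3) unfolding lower_frame_bound_def by blast
  obtain A2 B2 where B2: "frame_bounds J h A2 B2"
    using assms(2) unfolding is_frame_def by blast
  have g: "g i \<in> L2" if "i \<in> I" for i
    using B1 that unfolding frame_bounds_def by blast
  have h: "h j \<in> L2" if "j \<in> J" for j
    using B2 that unfolding frame_bounds_def by blast
  \<comment> \<open>For the upper bound, each of the two parts is a subfamily of one of the given
    frames, so \<open>B1 + B2\<close> suffices.\<close>
  have "frame_bounds ((I - F1) <+> F2) (case_sum g h) ((A1 - 2 * C) / m) (B1 + B2)"
    unfolding frame_bounds_def
  proof (intro conjI ballI)
    show "(A1 - 2 * C) / m > 0"
      using assms(10) m(1) by simp
    show "B1 + B2 > 0"
      using B1 B2 unfolding frame_bounds_def by simp
    show "case_sum g h k \<in> L2" if "k \<in> (I - F1) <+> F2" for k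
      using that g h assms(6) by (auto split: sum.split)
    fix f :: "real ^ 'd \<Rightarrow> complex"
    assume f: "f \<in> L2"
    define a where "a i = (cmod (inner_L2 f (g i)))\<^sup>2" for i
    define b where "b j = (cmod (inner_L2 f (h j)))\<^sup>2" for j
    have a: "a summable_on I" "A1 * (norm_L2 f)\<^sup>2 \<le> infsum a I" "infsum a I \<le> B1 * (norm_L2 f)\<^sup>2"
      using B1 f unfolding frame_bounds_def a_def by blast+
    have b: "b summable_on J" "infsum b J \<le> B2 * (norm_L2 f)\<^sup>2"
      using B2 f unfolding frame_bounds_def b_def by blast+
    have nonneg: "a i \<ge> 0" "b j \<ge> 0" for i j
      by (simp_all add: a_def b_def)
    have summable: "a summable_on (I - F1)"
      using a(1) by (rule summable_on_subset_banach) auto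
    have split: "infsum a I = infsum a (I - F1) + sum a F1"
      using infsum_Un_disjoint[OF summable summable_on_finite[OF assms(5)]] assms(4,5)
      by (simp add: Un_absorb2 inf_commute[of _ F1])
    have b_le: "sum b F2 \<le> infsum b J"
      using infsum_mono_neutral[of b F2 b J] assms(6,7) b(1) nonneg by auto
    let ?p = "\<lambda>k. (cmod (inner_L2 f (case_sum g h k)))\<^sup>2"
    have p: "(\<lambda>i. ?p (Inl i)) = a" "(\<lambda>j. ?p (Inr j)) = b"
      by (simp_all add: a_def b_def fun_eq_iff)
    show "?p summable_on (I - F1) <+> F2"
      by (rule summable_on_Plus) (use summable assms(7) in \<open>simp_all only: p summable_on_finite\<close>)
    have infsum_p: "infsum ?p ((I - F1) <+> F2) = infsum a (I - F1) + sum b F2"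
      using infsum_Plus[of ?p "I - F1" F2] summable assms(7) by (simp only: p summable_on_finite infsum_finite)
    \<comment> \<open>Here the squared operator norm of the difference becomes
      \<open>C\<close>.\<close>
    have "sum a F1 \<le> 2 * C * (norm_L2 f)\<^sup>2 + 2 * P\<^sup>2 * sum b F2"
      using coefficient_exchange[OF assms(8,5,7), of g h f] assms(4,6) g h f
      unfolding assms(9) P_def a_def b_def by blast
    with a(2) have "(A1 - 2 * C) * (norm_L2 f)\<^sup>2 \<le> infsum a (I - F1) + 2 * P\<^sup>2 * sum b F2"
      unfolding split by (simp add: left_diff_distrib)
    \<comment> \<open>The weights are \<open>1\<close> on the retained coefficients and
      \<open>2 * P^2\<close> on the new ones; \<open>m\<close> is the larger of the two, which
      explains the maximum in the bound.\<close>
    also have "\<dots> \<le> m * infsum a (I - F1) + m * sum b F2"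
      using m nonneg mult_right_mono[OF m(1) infsum_nonneg[of "I - F1" a]]
      by (intro add_mono mult_right_mono) (auto intro: sum_nonneg)
    finally show "(A1 - 2 * C) / m * (norm_L2 f)\<^sup>2 \<le> infsum ?p ((I - F1) <+> F2)"
      unfolding infsum_p using m(1) by (simp add: field_simps)
    show "infsum ?p ((I - F1) <+> F2) \<le> (B1 + B2) * (norm_L2 f)\<^sup>2"
      unfolding infsum_p using a(3) b(2) b_le sum_nonneg[of F1 a] nonneg
      by (simp add: split distrib_right)
  qed
  then show ?thesis
    unfolding is_frame_def lower_frame_bound_def m_def P_def by blast
qed

end
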